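(* Let $f$ and $g$ be entire functions (real on the real axis) satisfying $f(z)=2f(z/2)+g(z)$, let $A_m$ be defined by $e^xf(x)=\sum_{m\ge0}\frac{A_m}{m!}x^m$, and let $N\ge0$ be a fixed integer. Assume $E(g^{(N+1)};r)=O(r^{-N})$ as $r\to+\infty$. Then, as $n\to+\infty$ through integers, \[ A_n-\sum_{m=0}^{N}\frac{f^{(m)}(n)}{m!}\tau_m(n)=O\!\left(\frac{\log n}{n^{\frac{N-1}{2}}}\right). \]
   Context: For an entire function $h$ with $e^xh(x)=\sum_m\frac{B_m}{m!}x^m$, $E(h;r)=e^{-r}\sum_{m=0}^\infty\frac{|B_m|}{m!}r^m$. For integers $n\ge0$, $\tau_m(n)=n!\,[x^n]\bigl(e^x(x-n)^m\bigr)$, where $[x^n]$ denotes the coefficient of $x^n$; equivalently $\sum_m\frac{\tau_m(n)}{m!}z^m=((1+z)e^{-z})^n$. *)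

theory Defs
  imports "HOL-Complex_Analysis.Complex_Analysis" "HOL-Library.Landau_Symbols"
begin

text \<open>The sequence \<open>B\<^sub>m\<close> with \<open>exp x * h x = (\<Sum>m. B\<^sub>m / m! * x ^ m)\<close>, for entire \<^term>\<open>h\<close>.\<close>

definition pcoeff :: "(complex \<Rightarrow> complex) \<Rightarrow> nat \<Rightarrow> complex" where
  "pcoeff h m = fact m * fps_nth (fps_expansion (\<lambda>x. exp x * h x) 0) m"

lemma pcoeff_sums:
  assumes "h holomorphic_on UNIV"
  shows "(\<lambda>m. pcoeff h m / fact m * x ^ m) sums (exp x * h x)"
proof -
  have "(\<lambda>x. exp x * h x) holomorphic_on ball 0 (norm x + 1)"
    by (intro holomorphic_intros holomorphic_on_subset[OF assms]) auto
  from holomorphic_power_series[OF this, of x] show ?thesis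
    by (simp add: pcoeff_def fps_expansion_def)
qed

definition E :: "(complex \<Rightarrow> complex) \<Rightarrow> real \<Rightarrow> real" where
  "E h r = exp (- r) * (\<Sum>m. cmod (pcoeff h m) / fact m * r ^ m)"

text \<open>The sum defining \<^term>\<open>E h r\<close> genuinely converges for entire \<^term>\<open>h\<close>.\<close>

lemma E_summable:
  assumes "h holomorphic_on UNIV"
  shows "summable (\<lambda>m. cmod (pcoeff h m) / fact m * r ^ m)"
proof -
  have "summable (\<lambda>m. pcoeff h m / fact m * complex_of_real (\<bar>r\<bar> + 1) ^ m)"
    using pcoeff_sums[OF assms] by (rule sums_summable)
  from powser_insidea[OF this, of "complex_of_real r"]
  have "summable (\<lambda>m. cmod (cmod (pcoeff h m) / fact m * r ^ m))"
    by (simp add: norm_mult norm_divide norm_power abs_mult power_abs)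
  then have "summable (\<lambda>m. norm (cmod (pcoeff h m) / fact m * r ^ m))"
    by (simp only: norm_of_real real_norm_def)
  then show ?thesis
    by (rule summable_norm_cancel)
qed

definition tau :: "nat \<Rightarrow> nat \<Rightarrow> complex" where
  "tau m n = fact n * fps_nth (fps_exp 1 * (fps_X - of_nat n) ^ m) n"

end

theory Submission
  imports Defs
begin

text \<open>
  Put \<open>h = f\<^sup>(\<^sup>N\<^sup>+\<^sup>1\<^sup>)\<close> and \<open>exp t * h t = (\<Sum>k. B\<^sub>k / k! * t ^ k)\<close>. The polynomials
  \<open>q\<^sub>m t = n! [x\<^sup>n] (exp x * (x - t) ^ m / m!)\<close> satisfy \<open>q\<^sub>m' = - q\<^sub>m\<^sub>-\<^sub>1\<close> and \<open>q\<^sub>m n = \<tau>\<^sub>m n / m!\<close>, so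
  \<open>\<Sum>m\<le>N. f\<^sup>(\<^sup>m\<^sup>) t * q\<^sub>m t\<close> has derivative \<open>h t * q\<^sub>N t\<close> and the error term equals
  \<open>(\<Sum>k<n. B\<^sub>k * (n - k - 1 choose N)) - (\<integral>t\<in>{0..n}. h t * q\<^sub>N t)\<close>.
  Since \<open>(n - k - 1 choose N)\<close> is the integral of \<open>exp (- t) * t ^ k / k! * q\<^sub>N t\<close> over \<open>{0..}\<close> for
  \<open>k < n\<close>, the terms with \<open>k < n\<close> are integrated over \<open>t \<ge> n\<close> only and those with
  \<open>k \<ge> n\<close> over \<open>t \<le> n\<close> only. In both ranges \<open>t ^ k \<le> n ^ k * (t / n) ^ n\<close>, which gives the bound
  \<open>E h n * exp n / n ^ n\<close> times \<open>\<integral>t\<in>{0..}. exp (- t) * t ^ n * \<bar>q\<^sub>N t\<bar>\<close>. Under the Gamma distribution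
  \<open>t - n\<close> has size \<open>sqrt n\<close>, hence \<open>q\<^sub>N\<close> has size \<open>n powr (N / 2)\<close> and the error is
  \<open>O(n powr ((N + 1) / 2) * E h n)\<close>. Finally \<open>E (\<lambda>z. h (z / 2)) r \<le> E h (r / 2)\<close>, so iterating the
  functional equation yields \<open>E h r = O(ln r / r ^ N)\<close>.
\<close>

section \<open>The Gamma integral and factorials\<close>

text \<open>The substitution \<open>c * t\<close> in Euler's integral for Gamma. The case c = 1
  serves the moments; c = 1 - u arises when the Gamma weight is multiplied by exp(u * t).\<close>

lemma has_integral_power_exp:
  fixes c :: real
  assumes "c > 0"
  shows "((\<lambda>t. t ^ n * exp (- c * t)) has_integral fact n / c ^ Suc n) {0..}"
proof -
  have "((\<lambda>t. t ^ n * exp (- t)) has_integral fact n) {0::real..}"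
  \<comment> \<open>The two integrands can differ at t = 0: for n = 0, \<open>0 powr 0\<close> is 0
    while \<open>0 ^ 0\<close> is 1.\<close>
  proof (rule has_integral_spike_finite[where S = "{0}"])
    show "((\<lambda>t. t powr (real (Suc n) - 1) / exp t) has_integral fact n) {0..}"
      using Gamma_integral_real[of "real (Suc n)"] Gamma_fact[of n, where 'a = real]
      by (simp add: add.commute)
  qed (auto simp: powr_realpow exp_minus field_simps)
  moreover have "bij_betw (\<lambda>t. c * t) {0..} {0..}"
    by (rule bij_betwI[where g = "\<lambda>t. t / c"]) (use assms in auto)
  then have "(\<lambda>t. c * t) ` {0..} = {0..}" by (simp add: bij_betw_def)
  moreover have "(\<lambda>t. t ^ n * exp (- t)) absolutely_integrable_on {0::real..}"
    by (rule nonnegative_absolutely_integrable_1) (use calculation in auto)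
  ultimately have "(\<lambda>t. \<bar>c\<bar> * ((c * t) ^ n * exp (- (c * t)))) absolutely_integrable_on {0..} \<and>
      integral {0..} (\<lambda>t. \<bar>c\<bar> * ((c * t) ^ n * exp (- (c * t)))) = fact n"
    by (subst has_absolute_integral_change_of_variables_1'[where g = "\<lambda>t. c * t"])
       (use assms in \<open>auto intro!: derivative_eq_intros inj_onI\<close>)
  then have "((\<lambda>t. \<bar>c\<bar> * ((c * t) ^ n * exp (- (c * t)))) has_integral fact n) {0..}"
    by (auto simp: has_integral_iff set_lebesgue_integral_eq_integral)
  from has_integral_mult_right[OF this, of "1 / c ^ Suc n"] show ?thesis
    using assms by (simp add: power_mult_distrib field_simps)
qed

text \<open>Induction with equality at n = 1. The ratio of consecutive right-hand sides must be at
  least n + 1, which amounts to (n + 1/2) * ln(1 + 1/n) >= 1.\<close>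

lemma fact_le_Stirling:
  assumes "n \<ge> 1"
  shows "fact n \<le> exp 1 * sqrt (real n) * (real n / exp 1) ^ n"
  using assms
proof (induction n rule: dec_induct)
  case base
  then show ?case by simp
next
  case (step n)
  define x where "x = real n"
  have x: "x \<ge> 1" using step by (simp add: x_def)
  have "1 \<le> (x + 1/2) * ln (1 + 1/x)"
  proof -
    \<comment> \<open>This Pade bound for the logarithm is sharp enough: with y = 1/x, the quotient
      2 * y / (2 + y) is exactly 1 / (x + 1/2).\<close>
    have "2 * (1/x) / (2 + 1/x) \<le> ln (1 + 1/x)"
    proof -
      have "ln (1 + y) - 2 * y / (2 + y) \<ge> ln (1 + 0) - 2 * 0 / (2 + 0)" if "y \<ge> 0" for y :: real
      proof (rule DERIV_nonneg_imp_nondecreasing[OF that, where f = "\<lambda>y. ln (1 + y) - 2 * y / (2 + y)"])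
        fix z :: real assume z: "0 \<le> z"
        have "((\<lambda>y. ln (1 + y) - 2 * y / (2 + y)) has_real_derivative (1 / (1 + z) - 4 / (2 + z)^2)) (at z)"
          using z by (auto intro!: derivative_eq_intros simp: power2_eq_square algebra_simps)
        moreover have "1 / (1 + z) - 4 / (2 + z)^2 = z^2 / ((1 + z) * (2 + z)^2)"
        proof -
          have "1 + z \<noteq> 0" "(2 + z)^2 \<noteq> 0" using z by auto
          from diff_frac_eq[OF this, of 1 4] show ?thesis
            by (simp add: power2_eq_square algebra_simps)
        qed
        ultimately show "\<exists>d. ((\<lambda>y. ln (1 + y) - 2 * y / (2 + y)) has_real_derivative d) (at z) \<and> 0 \<le> d"
          using z by auto
      qed
      from this[of "1/x"] x show ?thesis by simp
    qed
    then have "(x + 1/2) * (2 * (1/x) / (2 + 1/x)) \<le> (x + 1/2) * ln (1 + 1/x)"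
      using x by (intro mult_left_mono) auto
    also have "(x + 1/2) * (2 * (1/x) / (2 + 1/x)) = 1"
      using x by (simp add: divide_simps)
    finally show ?thesis .
  qed
  also have "ln (1 + 1/x) = ln (x + 1) - ln x"
  proof -
    have "1 + 1/x = (x + 1) / x" using x by (simp add: add_divide_distrib)
    then show ?thesis using x ln_div[of "x + 1" x] by simp
  qed
  finally have *: "1 + (x + 1/2) * ln x \<le> (x + 1/2) * ln (x + 1)"
    by (simp add: algebra_simps)
  \<comment> \<open>Written as a single exponential, the induction step becomes a comparison of
    exponents.\<close>
  have pw: "exp 1 * sqrt y * (y / exp 1) ^ k = exp (1 + ln y / 2 + k * (ln y - 1))" if "y > 0" for y k
  proof -
    have "sqrt y = exp (ln y / 2)" using that by (simp add: ln_sqrt[symmetric])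
    moreover have "(y / exp 1) ^ k = exp (k * (ln y - 1))"
      using that by (simp add: exp_of_nat_mult exp_diff)
    ultimately show ?thesis by (simp add: exp_add)
  qed
  have "fact (Suc n) = (x + 1) * fact n" by (simp add: x_def)
  also have "\<dots> \<le> (x + 1) * exp (1 + ln x / 2 + x * (ln x - 1))"
    using step.IH x by (intro mult_left_mono) (simp_all add: pw x_def)
  also have "\<dots> = exp (ln (x + 1) + (1 + ln x / 2 + x * (ln x - 1)))"
    using x by (simp only: exp_add) simp
  also have "\<dots> \<le> exp (1 + ln (x + 1) / 2 + (x + 1) * (ln (x + 1) - 1))"
    using * by (simp add: algebra_simps)
  also have "\<dots> = exp 1 * sqrt (Suc n) * (Suc n / exp 1) ^ Suc n"
    by (subst pw) (simp_all add: x_def algebra_simps)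
  finally show ?case .
qed

section \<open>Laguerre polynomials\<close>

text \<open>In the standard notation this is the Laguerre polynomial \<open>L\<^sub>m\<close> with parameter \<open>n - m\<close>.\<close>

definition laguerre :: "nat \<Rightarrow> nat \<Rightarrow> real \<Rightarrow> real" where
  "laguerre n m t = (\<Sum>j\<le>m. real (n choose j) * (- t) ^ (m - j) / fact (m - j))"

lemma laguerre_0 [simp]: "laguerre n 0 t = 1"
  by (simp add: laguerre_def)

lemma laguerre_at_0: "laguerre n m 0 = real (n choose m)"
proof -
  have "laguerre n m 0 = (\<Sum>j\<le>m. if j = m then real (n choose j) else 0)"
    unfolding laguerre_def by (intro sum.cong) (auto simp: power_0_left)
  then show ?thesis by simp
qed

lemma laguerre_deriv:
  "(laguerre n m has_real_derivative (if m = 0 then 0 else - laguerre n (m - 1) t)) (at t)"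
proof (cases m)
  case (Suc k)
  have "((\<lambda>t. \<Sum>j\<le>m. real (n choose j) * (- t) ^ (m - j) / fact (m - j)) has_real_derivative
      (\<Sum>j\<le>m. real (n choose j) * (- (real (m - j) * (- t) ^ (m - j - 1))) / fact (m - j))) (at t)"
    by (auto intro!: derivative_eq_intros sum.cong)
  also have "(\<Sum>j\<le>m. real (n choose j) * (- (real (m - j) * (- t) ^ (m - j - 1))) / fact (m - j)) =
      (\<Sum>j\<le>k. real (n choose j) * (- (real (m - j) * (- t) ^ (m - j - 1))) / fact (m - j))"
    by (simp add: Suc)
  also have "\<dots> = - laguerre n k t"
    unfolding laguerre_def sum_negf[symmetric]
  proof (intro sum.cong refl)
    fix j assume "j \<in> {..k}"
    then have "m - j = Suc (k - j)" by (simp add: Suc Suc_diff_le)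
    then show "real (n choose j) * (- (real (m - j) * (- t) ^ (m - j - 1))) / fact (m - j) =
        - (real (n choose j) * (- t) ^ (k - j) / fact (k - j))"
      by (simp add: divide_simps)
  qed
  finally show ?thesis by (simp add: Suc laguerre_def[abs_def])
qed (simp add: laguerre_def[abs_def])

text \<open>A Cauchy product. At t = n the series is ((1 + z) * exp(-z))^n, the generating function
  of tau_m(n) / m!.\<close>

lemma fps_nth_laguerre:
  "fps_nth ((1 + fps_X) ^ n * fps_exp (- t)) m = laguerre n m t"
proof -
  have "fps_nth ((1 + fps_X :: real fps) ^ n) j = real (n choose j)" for j
  proof (induction n arbitrary: j)
    case (Suc n)
    then show ?case by (cases j) (simp_all add: distrib_right)
  qed (cases j; simp)
  then show ?thesis
    by (simp add: fps_mult_nth laguerre_def atMost_atLeast0)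
qed

text \<open>The generating function satisfies (1 + x) * F' = (n - t * (1 + x)) * F; the recurrence
  compares coefficients of x^(m+1).\<close>

lemma laguerre_recurrence:
  "real (m + 2) * laguerre n (m + 2) t
     = (real n - t - real (m + 1)) * laguerre n (m + 1) t - t * laguerre n m t"
proof -
  define F where "F = (1 + fps_X) ^ n * fps_exp (- t)"
  have *: "(1 + fps_X) * fps_deriv ((1 + fps_X) ^ n) = fps_const (real n) * (1 + fps_X) ^ n"
  proof (induction n)
    case (Suc n)
    have "(1 + fps_X) * fps_deriv ((1 + fps_X) ^ Suc n) =
        (1 + fps_X) * (1 + fps_X) ^ n + (1 + fps_X) * ((1 + fps_X) * fps_deriv ((1 + fps_X :: real fps) ^ n))"
      by (simp add: algebra_simps)
    also have "\<dots> = (1 + fps_const (real n)) * (1 + fps_X) ^ Suc n"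
      unfolding Suc.IH by (simp add: algebra_simps)
    finally show ?case by simp
  qed simp
  have "(1 + fps_X) * fps_deriv F = (1 + fps_X) * fps_deriv ((1 + fps_X) ^ n) * fps_exp (- t)
      - fps_const t * ((1 + fps_X) * F)"
    by (simp add: F_def algebra_simps fps_const_neg[symmetric] del: fps_const_neg)
  also have "\<dots> = fps_const (real n) * F - fps_const t * ((1 + fps_X) * F)"
    unfolding * by (simp add: F_def algebra_simps)
  finally have "(1 + fps_X) * fps_deriv F = fps_const (real n) * F - fps_const t * ((1 + fps_X) * F)" .
  then have "fps_nth ((1 + fps_X) * fps_deriv F) (m + 1) =
    fps_nth (fps_const (real n) * F - fps_const t * ((1 + fps_X) * F)) (m + 1)" by simp
  moreover have "fps_nth F k = laguerre n k t" for k
    by (simp add: F_def fps_nth_laguerre)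
  ultimately show ?thesis
    by (simp add: distrib_right) (simp add: algebra_simps)
qed

section \<open>Size of the Laguerre polynomials under the Gamma weight\<close>

text \<open>Induction along the recurrence with Y = |n - t| + sqrt n: the coefficient n - t - (m +
  1) is O(Y) and t is O(Y^2), so each increase of the index costs one factor Y.\<close>

lemma laguerre_bound:
  "\<exists>C\<ge>0. \<forall>n\<ge>1. \<forall>t\<ge>0. \<bar>laguerre n m t\<bar> \<le> C * (\<bar>real n - t\<bar> + sqrt (real n)) ^ m"
proof (induction m rule: induct_nat_012)
  case 0
  show ?case by (rule exI[of _ 1]) simp
next
  case 1
  have "\<bar>laguerre n 1 t\<bar> \<le> 1 * (\<bar>real n - t\<bar> + sqrt (real n)) ^ 1" for n t
  proof -
    have "\<bar>real n - t\<bar> \<le> \<bar>real n - t\<bar> + sqrt (real n)" by simp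
    then show ?thesis by (simp add: laguerre_def)
  qed
  then show ?case by (metis One_nat_def zero_le_one)
next
  case (ge2 m)
  then obtain C D where CD: "C \<ge> 0" "D \<ge> 0"
    and C: "\<And>n t. n \<ge> 1 \<Longrightarrow> t \<ge> 0 \<Longrightarrow> \<bar>laguerre n m t\<bar> \<le> C * (\<bar>real n - t\<bar> + sqrt (real n)) ^ m"
    and D: "\<And>n t. n \<ge> 1 \<Longrightarrow> t \<ge> 0 \<Longrightarrow> \<bar>laguerre n (Suc m) t\<bar> \<le> D * (\<bar>real n - t\<bar> + sqrt (real n)) ^ Suc m"
    by metis
  have "\<bar>laguerre n (Suc (Suc m)) t\<bar> \<le> (real (m + 2) * D + C) * (\<bar>real n - t\<bar> + sqrt (real n)) ^ Suc (Suc m)"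
    if n: "n \<ge> 1" and t: "t \<ge> 0" for n t
  proof -
    define Y where "Y = \<bar>real n - t\<bar> + sqrt (real n)"
    have sq: "sqrt (real n) \<ge> 1" using n by simp
    then have Y: "Y \<ge> 1" "\<bar>real n - t\<bar> \<le> Y" unfolding Y_def by linarith+
    have "t \<le> \<bar>real n - t\<bar> * 1 + real n" by simp
    \<comment> \<open>The factor 1 is enlarged so that the expression becomes the expanded square of
      Y.\<close>
    also have "\<dots> \<le> \<bar>real n - t\<bar> * (\<bar>real n - t\<bar> + 2 * sqrt n) + real n"
    proof -
      have "1 \<le> \<bar>real n - t\<bar> + 2 * sqrt n" using sq by linarith
      then show ?thesis by (intro add_mono mult_left_mono) auto
    qed
    also have "\<dots> = Y ^ 2" by (simp add: Y_def power2_eq_square algebra_simps)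
    finally have tY: "t \<le> Y ^ 2" .
    have "\<bar>real n - t - real (m + 1)\<bar> \<le> \<bar>real n - t\<bar> + real (m + 1) * 1" by simp
    also have "\<dots> \<le> Y + real (m + 1) * Y" using Y by (intro add_mono mult_left_mono) auto
    finally have 1: "\<bar>real n - t - real (m + 1)\<bar> \<le> real (m + 2) * Y" by (simp add: algebra_simps)
    have "\<bar>laguerre n (Suc (Suc m)) t\<bar> \<le> real (m + 2) * \<bar>laguerre n (Suc (Suc m)) t\<bar>"
      by (simp add: algebra_simps)
    also have "\<dots> = \<bar>(real n - t - real (m + 1)) * laguerre n (m + 1) t - t * laguerre n m t\<bar>"
      unfolding laguerre_recurrence[symmetric] by (simp add: abs_mult)
    also have "\<dots> \<le> \<bar>real n - t - real (m + 1)\<bar> * \<bar>laguerre n (m + 1) t\<bar> + t * \<bar>laguerre n m t\<bar>"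
      using t by (metis abs_mult abs_of_nonneg abs_triangle_ineq4)
    also have "\<dots> \<le> (real (m + 2) * Y) * (D * Y ^ Suc m) + Y ^ 2 * (C * Y ^ m)"
    proof (intro add_mono mult_mono 1 tY)
      show "\<bar>laguerre n (m + 1) t\<bar> \<le> D * Y ^ Suc m" "\<bar>laguerre n m t\<bar> \<le> C * Y ^ m"
        using C[OF n t] D[OF n t] by (simp_all only: Y_def Suc_eq_plus1)
      show "0 \<le> real (m + 2) * Y" "0 \<le> Y ^ 2" using Y by simp_all
    qed simp_all
    also have "\<dots> = (real (m + 2) * D + C) * Y ^ Suc (Suc m)"
      by (simp add: algebra_simps power2_eq_square)
    finally show ?thesis by (simp add: Y_def)
  qed
  moreover have "real (m + 2) * D + C \<ge> 0" using CD by simp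
  ultimately show ?case by blast
qed

text \<open>The left-hand side is the moment generating function at \<open>u\<close> of \<open>t - n\<close>, for \<open>t\<close> Gamma
  distributed with shape \<open>n + 1\<close>.\<close>

lemma gamma_mgf_bound:
  fixes u :: real
  assumes "\<bar>u\<bar> \<le> 1/2" and "u\<^sup>2 * real n \<le> 1/4" and "n \<ge> 1"
  shows "exp (- u * real n) / (1 - u) ^ Suc n \<le> exp 2"
proof -
  \<comment> \<open>Second order suffices: the linear term n * u of -(n + 1) * ln(1 - u) is
    cancelled by the centring factor exp(-u * n), and u^2 * n is bounded by hypothesis.\<close>
  have "\<bar>ln (1 + - u) - - u\<bar> \<le> 2 * (- u)\<^sup>2"
    using assms by (intro abs_ln_one_plus_x_minus_x_bound) auto
  then have "- ln (1 - u) \<le> u + 2 * u\<^sup>2" by simp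
  then have "real (Suc n) * - ln (1 - u) \<le> real (Suc n) * (u + 2 * u\<^sup>2)"
    by (intro mult_left_mono) auto
  then have "- u * real n - real (Suc n) * ln (1 - u) \<le> u + 2 * (u\<^sup>2 * real n) + 2 * u\<^sup>2"
    by (simp add: algebra_simps)
  also have "\<dots> \<le> 2"
  proof -
    have "u\<^sup>2 * 1 \<le> u\<^sup>2 * real n" using assms by (intro mult_left_mono) auto
    then show ?thesis using assms by linarith
  qed
  finally have "exp (- u * real n - real (Suc n) * ln (1 - u)) \<le> exp 2" by simp
  moreover have "exp (real (Suc n) * ln (1 - u)) = (1 - u) ^ Suc n"
    using assms by (subst exp_of_nat_mult) simp
  ultimately show ?thesis by (simp only: exp_diff)
qed

text \<open>The power of x = (1 + y) / 2 over m! is a single term of the series for exp x. The rate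
  1/2 is slow enough for the exponential to be absorbed by \<open>gamma_mgf_bound\<close>.\<close>

lemma power_le_exp_half:
  fixes y :: real
  assumes "y \<ge> 0"
  shows "(1 + y) ^ m \<le> 2 ^ m * fact m * exp 1 * exp (y / 2)"
proof -
  define x where "x = (1 + y) / 2"
  have x: "x \<ge> 0" using assms by (simp add: x_def)
  have sums: "(\<lambda>k. x ^ k / fact k) sums exp x"
    using exp_converges[of x] by (simp add: field_simps)
  have "(\<Sum>k\<in>{m}. x ^ k / fact k) \<le> (\<Sum>k. x ^ k / fact k)"
    using x sums by (intro sum_le_suminf) (auto simp: sums_iff)
  then have "x ^ m / fact m \<le> exp x" using sums by (simp add: sums_iff)
  then have "x ^ m \<le> fact m * exp x" by (simp add: field_simps)
  then have "2 ^ m * x ^ m \<le> 2 ^ m * (fact m * exp x)" by (intro mult_left_mono) auto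
  also have "exp x = exp (1/2) * exp (y / 2)"
    by (simp add: x_def add_divide_distrib flip: exp_add)
  also have "2 ^ m * (fact m * (exp (1/2) * exp (y / 2))) \<le> 2 ^ m * (fact m * (exp 1 * exp (y / 2)))"
    by (intro mult_left_mono mult_right_mono) auto
  also have "2 ^ m * x ^ m = (1 + y) ^ m"
    by (simp add: x_def power_divide)
  finally show ?thesis by (simp add: algebra_simps)
qed

text \<open>The polynomial bound is replaced by exponentials in t - n, whose Gamma integrals are
  explicit. A majorant \<open>G\<close> with known integral is all that the later domination
  argument requires.\<close>

lemma laguerre_weighted_integral:
  "\<exists>C\<ge>0. \<forall>n\<ge>1. \<exists>G I. (G has_integral I) {0..} \<and> I \<le> C * sqrt (real n) ^ m * fact n \<and>
     (\<forall>t\<ge>0. exp (- t) * t ^ n * \<bar>laguerre n m t\<bar> \<le> G t)"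
proof -
  obtain C where C: "C \<ge> 0" "\<And>n t. n \<ge> 1 \<Longrightarrow> t \<ge> 0 \<Longrightarrow>
      \<bar>laguerre n m t\<bar> \<le> C * (\<bar>real n - t\<bar> + sqrt (real n)) ^ m"
    using laguerre_bound[of m] by blast
  define K where "K = C * (2 ^ m * fact m * exp 1)"
  have K: "K \<ge> 0" using C by (simp add: K_def)
  have "\<exists>G I. (G has_integral I) {0..} \<and> I \<le> (K * (2 * exp 2)) * sqrt (real n) ^ m * fact n \<and>
     (\<forall>t\<ge>0. exp (- t) * t ^ n * \<bar>laguerre n m t\<bar> \<le> G t)" if n: "n \<ge> 1" for n
  proof -
    \<comment> \<open>Chosen so that s^2 * n = 1/4, as \<open>gamma_mgf_bound\<close> demands, and s
      * |n - t| is the exponent y / 2 of \<open>power_le_exp_half\<close>.\<close>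
    define s where "s = 1 / (2 * sqrt (real n))"
    have sq: "sqrt (real n) \<ge> 1" using n by simp
    have s: "0 < s" "s \<le> 1/2" "s\<^sup>2 * real n \<le> 1/4"
      using n sq by (auto simp: s_def field_simps power2_eq_square)
    \<comment> \<open>This is the Gamma weight exp(-t) * t^n times exp(u * (t - n)). Both signs u =
      s and u = -s enter \<open>G\<close>, since exp(s * |t - n|) is at most the sum of the
      two.\<close>
    define g where "g u t = exp (- u * real n) * (t ^ n * exp (- (1 - u) * t))" for u t
    have g: "(g u has_integral exp (- u * real n) * (fact n / (1 - u) ^ Suc n)) {0..}" if "\<bar>u\<bar> = s" for u
      unfolding g_def using s that by (intro has_integral_mult_right has_integral_power_exp) auto
    define G where "G t = K * sqrt (real n) ^ m * (g s t + g (- s) t)" for t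
    have "(G has_integral K * sqrt (real n) ^ m * (exp (- s * real n) * (fact n / (1 - s) ^ Suc n) +
        exp (- (- s) * real n) * (fact n / (1 - - s) ^ Suc n))) {0..}"
      unfolding G_def using s by (intro has_integral_mult_right has_integral_add g) auto
    moreover have "exp (- u * real n) * (fact n / (1 - u) ^ Suc n) \<le> fact n * exp 2" if "\<bar>u\<bar> = s" for u
    proof -
      have "u\<^sup>2 = s\<^sup>2" using that by (metis power2_abs)
      then have "fact n * (exp (- u * real n) / (1 - u) ^ Suc n) \<le> fact n * exp 2"
        using s n that by (intro mult_left_mono gamma_mgf_bound) auto
      then show ?thesis by (simp add: mult_ac)
    qed
    from add_mono[OF this[of s] this[of "- s"]]
    have "K * sqrt (real n) ^ m * (exp (- s * real n) * (fact n / (1 - s) ^ Suc n) +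
        exp (- (- s) * real n) * (fact n / (1 - - s) ^ Suc n)) \<le> K * sqrt (real n) ^ m * (fact n * exp 2 + fact n * exp 2)"
      using s K by (intro mult_left_mono) simp_all
    moreover have "exp (- t) * t ^ n * \<bar>laguerre n m t\<bar> \<le> G t" if t: "t \<ge> 0" for t
    proof -
      define y where "y = \<bar>real n - t\<bar> / sqrt (real n)"
      have y: "y \<ge> 0" by (simp add: y_def)
      have ys: "y / 2 = s * \<bar>real n - t\<bar>" by (simp add: y_def s_def)
      have "\<bar>laguerre n m t\<bar> \<le> C * (sqrt (real n) * (1 + y)) ^ m"
        using C(2)[OF n t] sq by (simp add: y_def distrib_left add.commute)
      also have "\<dots> = C * sqrt (real n) ^ m * (1 + y) ^ m" by (simp add: power_mult_distrib)
      also have "\<dots> \<le> C * sqrt (real n) ^ m * (2 ^ m * fact m * exp 1 * exp (y / 2))"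
        using y C by (intro mult_left_mono power_le_exp_half) auto
      also have "\<dots> = K * sqrt (real n) ^ m * exp (y / 2)" by (simp add: K_def)
      also have "\<dots> \<le> K * sqrt (real n) ^ m * (exp (s * (t - real n)) + exp (- s * (t - real n)))"
        using K unfolding ys by (intro mult_left_mono) (auto simp: abs_if algebra_simps)
      finally have "exp (- t) * t ^ n * \<bar>laguerre n m t\<bar> \<le>
         exp (- t) * t ^ n * (K * sqrt (real n) ^ m * (exp (s * (t - real n)) + exp (- s * (t - real n))))"
        using t by (intro mult_left_mono) auto
      also have "\<dots> = K * sqrt (real n) ^ m * (t ^ n * exp (- t + s * (t - real n)) + t ^ n * exp (- t + - s * (t - real n)))"
        by (simp only: exp_add) (simp add: algebra_simps)
      also have "\<dots> = G t"
        by (simp add: G_def g_def algebra_simps flip: exp_add)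
      finally show ?thesis .
    qed
    ultimately show ?thesis by (intro exI[of _ G] exI) (auto simp: mult_ac)
  qed
  then show ?thesis using K by (intro exI[of _ "K * (2 * exp 2)"]) auto
qed

section \<open>Binomial sums, moments and the link to \<open>tau\<close>\<close>

text \<open>Since (-1)^l * (k + l choose k) is the generalized binomial coefficient of -(k + 1) over
  l, this is Vandermonde's identity with upper entries n and -(k + 1), which add up to n - k -
  1.\<close>

lemma alternating_Vandermonde:
  assumes "k < n"
  shows "(\<Sum>j\<le>M. real (n choose j) * ((- 1) ^ (M - j) * real ((k + (M - j)) choose k))) = real ((n - k - 1) choose M)"
proof -
  have "(- 1) ^ l * real ((k + l) choose k) = (- real (Suc k)) gchoose l" for l
  proof -
    have "real ((k + l) choose k) = real (k + l) gchoose l"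
      by (metis add_diff_cancel_left' binomial_gbinomial binomial_symmetric le_add1)
    then show ?thesis using gbinomial_minus[of "real (Suc k)" l] by simp
  qed
  then have "(\<Sum>j\<le>M. real (n choose j) * ((- 1) ^ (M - j) * real ((k + (M - j)) choose k))) =
      (\<Sum>j\<in>{0..M}. (real n gchoose j) * ((- real (Suc k)) gchoose (M - j)))"
    by (simp only: binomial_gbinomial[of n] atMost_atLeast0)
  also have "\<dots> = (real n + - real (Suc k)) gchoose M"
    by (rule gbinomial_Vandermonde)
  also have "real n + - real (Suc k) = real (n - k - 1)"
    using assms by simp
  finally show ?thesis by (simp add: binomial_gbinomial)
qed

text \<open>Reversing the sum by the symmetry of \<open>n choose _\<close> leads to the previous
  identity with lower index M = n - N - 1 - k, and M + N = n - k - 1. Thus the Taylor coefficients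
  at 0 and the Gamma moments produce the same binomial coefficient.\<close>

lemma alternating_Vandermonde_shift:
  assumes "k < n" "N < n"
  shows "(\<Sum>i<n - N. real (n choose (N + 1 + i)) * ((- 1) ^ (i - k) * real (i choose k))) = real ((n - k - 1) choose N)"
proof (cases "k < n - N")
  case True
  define M where "M = n - N - 1 - k"
  have "(\<Sum>i<n - N. real (n choose (N + 1 + i)) * ((- 1) ^ (i - k) * real (i choose k))) =
        (\<Sum>i\<in>{k..<n - N}. real (n choose (N + 1 + i)) * ((- 1) ^ (i - k) * real (i choose k)))"
    \<comment> \<open>For i < k the factor \<open>i choose k\<close> is 0, so the truncated
      difference \<open>i - k\<close> does no harm.\<close>
    by (rule sum.mono_neutral_right) auto
  also have "\<dots> = (\<Sum>j\<le>M. real (n choose j) * ((- 1) ^ (M - j) * real ((k + (M - j)) choose k)))"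
  proof (rule sum.reindex_bij_witness[of _ "\<lambda>j. k + (M - j)" "\<lambda>i. M - (i - k)"])
    fix i assume i: "i \<in> {k..<n - N}"
    show "k + (M - (M - (i - k))) = i" using i True by (auto simp: M_def)
    show "M - (i - k) \<in> {..M}" by simp
    have "n - (N + 1 + i) = M - (i - k)" using i by (auto simp: M_def)
    then have "n choose (M - (i - k)) = n choose (N + 1 + i)"
      using i by (metis (no_types, lifting) Suc_eq_plus1 Suc_leI add.commute add_Suc_right atLeastLessThan_iff binomial_symmetric less_diff_conv)
    moreover have "M - (M - (i - k)) = i - k" using i by (auto simp: M_def)
    ultimately show "real (n choose (M - (i - k))) * ((- 1) ^ (M - (M - (i - k))) * real ((k + (M - (M - (i - k)))) choose k)) =
       real (n choose (N + 1 + i)) * ((- 1) ^ (i - k) * real (i choose k))"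
      using i by simp
  next
    fix j assume j: "j \<in> {..M}"
    show "M - (k + (M - j) - k) = j" using j by auto
    show "k + (M - j) \<in> {k..<n - N}" using True by (auto simp: M_def)
  qed
  also have "\<dots> = real ((n - k - 1) choose M)"
    using assms(1) by (rule alternating_Vandermonde)
  also have "(n - k - 1) choose M = (n - k - 1) choose N"
    using True binomial_symmetric[of N "n - k - 1"] by (simp add: M_def add.commute)
  finally show ?thesis .
\<comment> \<open>In the remaining case k >= n - N both sides are 0.\<close>
next
  case False
  then have "n - k - 1 < N" using assms by linarith
  moreover have "i < k" if "i < n - N" for i using that False by linarith
  then have "(\<Sum>i<n - N. real (n choose (N + 1 + i)) * ((- 1) ^ (i - k) * real (i choose k))) = 0"
    by (intro sum.neutral) auto
  ultimately show ?thesis by (simp add: binomial_eq_0)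
qed

text \<open>Termwise Gamma integrals give (k + N - j)!, which over k! * (N - j)! is a binomial
  coefficient, so that \<open>alternating_Vandermonde\<close> applies.\<close>

lemma laguerre_moment:
  assumes "k < n"
  shows "((\<lambda>t. exp (- t) * t ^ k * laguerre n N t) has_integral fact k * real ((n - k - 1) choose N)) {0..}"
proof -
  have "((\<lambda>t. \<Sum>j\<le>N. (real (n choose j) * (- 1) ^ (N - j) / fact (N - j)) * (t ^ (k + (N - j)) * exp (- 1 * t))) has_integral
      (\<Sum>j\<le>N. (real (n choose j) * (- 1) ^ (N - j) / fact (N - j)) * (fact (k + (N - j)) / 1 ^ Suc (k + (N - j))))) {0..}"
    by (intro has_integral_sum has_integral_mult_right has_integral_power_exp) auto
  also have "(\<lambda>t. \<Sum>j\<le>N. (real (n choose j) * (- 1) ^ (N - j) / fact (N - j)) * (t ^ (k + (N - j)) * exp (- 1 * t))) =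
      (\<lambda>t. exp (- t) * t ^ k * laguerre n N t)"
    unfolding laguerre_def sum_distrib_left
  proof (intro ext sum.cong refl)
    fix t :: real and j
    show "real (n choose j) * (- 1) ^ (N - j) / fact (N - j) * (t ^ (k + (N - j)) * exp (- 1 * t)) =
        exp (- t) * t ^ k * (real (n choose j) * (- t) ^ (N - j) / fact (N - j))"
      unfolding power_minus[of t] power_add by simp
  qed
  also have "(\<Sum>j\<le>N. (real (n choose j) * (- 1) ^ (N - j) / fact (N - j)) * (fact (k + (N - j)) / 1 ^ Suc (k + (N - j)))) =
      fact k * (\<Sum>j\<le>N. real (n choose j) * ((- 1) ^ (N - j) * real ((k + (N - j)) choose k)))"
    unfolding sum_distrib_left by (intro sum.cong refl) (simp add: binomial_fact field_simps)
  also have "\<dots> = fact k * real ((n - k - 1) choose N)"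
    using alternating_Vandermonde[OF assms] by simp
  finally show ?thesis .
qed

text \<open>Expanding (x - n)^m and reading off [x^n] (exp x * x^j) = 1 / (n - j)!; then n! / (n -
  j)! * (m choose j) = m! / (m - j)! * (n choose j), with both sides read as 0 for j > n.\<close>

lemma tau_laguerre: "tau m n = fact m * of_real (laguerre n m (real n))"
proof -
  have X: "fps_nth (fps_exp 1 * (fps_X :: complex fps) ^ j) n = (if j \<le> n then 1 / fact (n - j) else 0)" for j
    using fps_X_power_mult_nth[of j "fps_exp 1 :: complex fps" n] by (simp add: mult.commute)
  have "(fps_X - of_nat n :: complex fps) ^ m = (fps_X + fps_const (- of_nat n)) ^ m"
    by (simp add: fps_of_nat flip: fps_const_neg)
  also have "\<dots> = (\<Sum>j\<le>m. fps_const (of_nat (m choose j) * (- of_nat n) ^ (m - j)) * fps_X ^ j)"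
    unfolding binomial_ring by (intro sum.cong refl) (simp add: fps_of_nat[symmetric] mult_ac flip: fps_const_power fps_const_mult)
  finally have "tau m n = fact n * (\<Sum>j\<le>m. of_nat (m choose j) * (- of_nat n) ^ (m - j) * (if j \<le> n then 1 / fact (n - j) else 0))"
    using X unfolding tau_def
    by (simp add: sum_distrib_left fps_sum_nth mult.left_commute[of "fps_exp 1"])
  also have "\<dots> = (\<Sum>j\<le>m. fact m * (of_nat (n choose j) * (- of_nat n) ^ (m - j) / fact (m - j)))"
    unfolding sum_distrib_left
  proof (intro sum.cong refl)
    fix j assume "j \<in> {..m}"
    then show "fact n * (of_nat (m choose j) * (- of_nat n) ^ (m - j) * (if j \<le> n then 1 / fact (n - j) else 0)) =
      fact m * (of_nat (n choose j) * (- of_nat n) ^ (m - j) / fact (m - j) :: complex)"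
      by (cases "j \<le> n") (simp_all add: binomial_fact field_simps)
  qed
  finally show ?thesis by (simp add: laguerre_def sum_distrib_left)
qed

section \<open>The remainder as an integral\<close>

lemma entire_has_fps_expansion:
  assumes "h holomorphic_on UNIV"
  shows "h has_fps_expansion fps_expansion h 0"
  using assms by (intro has_fps_expansion_fps_expansion[of UNIV]) auto

lemma fps_expansion_exp_mult:
  assumes "h holomorphic_on UNIV"
  shows "fps_expansion (\<lambda>x. exp x * h x) 0 = fps_exp 1 * fps_expansion h 0"
proof (rule fps_expansion_unique_complex)
  show "(\<lambda>x. exp x * h x) has_fps_expansion fps_expansion (\<lambda>x. exp x * h x) 0"
    using assms by (intro entire_has_fps_expansion holomorphic_intros)
  show "(\<lambda>x. exp x * h x) has_fps_expansion fps_exp 1 * fps_expansion h 0"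
    using entire_has_fps_expansion[OF assms] has_fps_expansion_exp[of 1]
    by (intro has_fps_expansion_mult) simp_all
qed

lemma pcoeff_eq_sum_deriv:
  assumes "h holomorphic_on UNIV"
  shows "pcoeff h n = (\<Sum>j\<le>n. of_nat (n choose j) * (deriv ^^ j) h 0)"
proof -
  have "pcoeff h n = (\<Sum>j\<le>n. fact n * ((deriv ^^ j) h 0 / fact j * (1 / fact (n - j))))"
    using assms unfolding pcoeff_def fps_expansion_exp_mult[OF assms] mult.commute[of "fps_exp 1"]
    by (simp add: fps_mult_nth fps_expansion_def atMost_atLeast0 sum_distrib_left)
  also have "\<dots> = (\<Sum>j\<le>n. of_nat (n choose j) * (deriv ^^ j) h 0)"
    by (intro sum.cong refl) (simp add: binomial_fact)
  finally show ?thesis .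
qed

text \<open>Binomial inversion of \<open>pcoeff_eq_sum_deriv\<close>: multiplication by exp(-x)
  undoes multiplication by exp x.\<close>

lemma deriv_eq_sum_pcoeff:
  assumes "h holomorphic_on UNIV"
  shows "(deriv ^^ n) h 0 = (\<Sum>j\<le>n. of_nat (n choose j) * (- 1) ^ (n - j) * pcoeff h j)"
proof -
  define P where "P = fps_expansion (\<lambda>x. exp x * h x) 0"
  have "fps_expansion h 0 = fps_exp (- 1) * fps_exp 1 * fps_expansion h 0"
    by (simp flip: fps_exp_add_mult)
  also have "\<dots> = P * fps_exp (- 1)"
    by (simp add: P_def fps_expansion_exp_mult[OF assms] mult_ac)
  finally have "fps_nth (fps_expansion h 0) n = fps_nth (P * fps_exp (- 1)) n"
    by simp
  then have "(deriv ^^ n) h 0 = fact n * fps_nth (P * fps_exp (- 1)) n"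
    by (simp add: fps_expansion_def field_simps)
  also have "\<dots> = (\<Sum>j\<le>n. fact n * (pcoeff h j / fact j * ((- 1) ^ (n - j) / fact (n - j))))"
    by (simp add: fps_mult_nth atMost_atLeast0 sum_distrib_left pcoeff_def P_def)
  also have "\<dots> = (\<Sum>j\<le>n. of_nat (n choose j) * (- 1) ^ (n - j) * pcoeff h j)"
    by (intro sum.cong refl) (simp add: binomial_fact)
  finally show ?thesis .
qed

text \<open>Interpolates between two sums: at t = n it is the approximation to
  \<open>pcoeff f n\<close> in the theorem, at t = 0 the part j <= N of the binomial formula for
  \<open>pcoeff f n\<close>.\<close>

definition laguerre_sum :: "nat \<Rightarrow> (complex \<Rightarrow> complex) \<Rightarrow> nat \<Rightarrow> real \<Rightarrow> complex" where
  "laguerre_sum N f n t = (\<Sum>m\<le>N. (deriv ^^ m) f (of_real t) * of_real (laguerre n m t))"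

text \<open>The product rule telescopes: differentiating the Laguerre factor of index m cancels what
  differentiating f left over at index m - 1.\<close>

lemma laguerre_sum_derivative:
  assumes "f holomorphic_on UNIV"
  shows "(laguerre_sum N f n has_vector_derivative
           (deriv ^^ Suc N) f (of_real t) * of_real (laguerre n N t)) (at t within S)"
proof (induction N)
  have d: "((\<lambda>t. (deriv ^^ m) f (of_real t)) has_vector_derivative (deriv ^^ Suc m) f (of_real t)) (at t within S)" for m
  proof -
    have "(deriv ^^ m) f field_differentiable at (of_real t)"
      using holomorphic_higher_deriv[OF assms, of m]
      by (intro holomorphic_on_imp_differentiable_at[of _ UNIV]) auto
    then have "((deriv ^^ m) f has_field_derivative (deriv ^^ Suc m) f (of_real t)) (at (of_real t) within of_real ` S)"
      by (auto simp: DERIV_deriv_iff_field_differentiable intro: has_field_derivative_at_within)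
    from field_vector_diff_chain_within[OF has_vector_derivative_of_real[OF DERIV_ident] this]
    show ?thesis by (simp add: o_def)
  qed
  have q: "((\<lambda>t. complex_of_real (laguerre n m t)) has_vector_derivative
      of_real (if m = 0 then 0 else - laguerre n (m - 1) t)) (at t within S)" for m
    by (rule has_vector_derivative_of_real[OF has_field_derivative_at_within[OF laguerre_deriv]])
  {
    case 0
    show ?case using d[of 0] by (simp add: laguerre_sum_def[abs_def])
  next
    case (Suc N)
    show ?case
      using has_vector_derivative_add[OF Suc has_vector_derivative_mult[OF d[of "Suc N"] q[of "Suc N"]]]
      by (simp add: laguerre_sum_def[abs_def] algebra_simps)
  }
qed

text \<open>The integral is the change of \<open>laguerre_sum\<close> from 0 to n. At 0 the binomial
  formula leaves the terms j > N, which involve only derivatives of \<open>h\<close> at 0 and hence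
  its coefficients \<open>pcoeff h k\<close>.\<close>

lemma pcoeff_remainder:
  assumes f: "f holomorphic_on UNIV" and n: "N < n"
  defines "h \<equiv> (deriv ^^ (N + 1)) f"
  shows "((\<lambda>t. h (of_real t) * of_real (laguerre n N t)) has_integral
     (\<Sum>k<n. pcoeff h k * of_nat ((n - k - 1) choose N)) -
     (pcoeff f n - (\<Sum>m=0..N. (deriv ^^ m) f (of_nat n) / fact m * tau m n))) {0..real n}"
proof -
  have h: "h holomorphic_on UNIV"
    unfolding h_def using f by (intro holomorphic_higher_deriv) auto
  have hf: "(deriv ^^ i) h = (deriv ^^ (i + (N + 1))) f" for i
    by (simp only: h_def funpow_add o_def)
  have "((\<lambda>t. h (of_real t) * of_real (laguerre n N t)) has_integral
      laguerre_sum N f n (real n) - laguerre_sum N f n 0) {0..real n}"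
    unfolding h_def using laguerre_sum_derivative[OF f]
    by (intro fundamental_theorem_of_calculus) auto
  moreover have "laguerre_sum N f n (real n) = (\<Sum>m=0..N. (deriv ^^ m) f (of_nat n) / fact m * tau m n)"
    by (simp add: laguerre_sum_def tau_laguerre atMost_atLeast0)
  moreover have "pcoeff f n - laguerre_sum N f n 0 = (\<Sum>k<n. pcoeff h k * of_nat ((n - k - 1) choose N))"
  proof -
    have "pcoeff f n = (\<Sum>j\<in>{..N} \<union> {N<..n}. of_nat (n choose j) * (deriv ^^ j) f 0)"
      unfolding pcoeff_eq_sum_deriv[OF f] using n by (intro sum.cong) auto
    also have "\<dots> = laguerre_sum N f n 0 + (\<Sum>j\<in>{N<..n}. of_nat (n choose j) * (deriv ^^ j) f 0)"
      by (subst sum.union_disjoint) (auto simp: laguerre_sum_def laguerre_at_0 mult.commute)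
    also have "(\<Sum>j\<in>{N<..n}. of_nat (n choose j) * (deriv ^^ j) f 0) =
        (\<Sum>i<n - N. of_nat (n choose (N + 1 + i)) * (deriv ^^ i) h 0)"
      by (rule sum.reindex_bij_witness[of _ "\<lambda>i. N + 1 + i" "\<lambda>j. j - N - 1"])
         (auto simp: hf simp del: funpow.simps)
    \<comment> \<open>The inner range k <= i is enlarged to k < n by vanishing binomials, so the two
      sums can be swapped.\<close>
    also have "\<dots> = (\<Sum>i<n - N. \<Sum>k<n. of_real (real (n choose (N + 1 + i)) * ((- 1) ^ (i - k) * real (i choose k))) * pcoeff h k)"
    proof (intro sum.cong refl)
      fix i assume "i \<in> {..<n - N}"
      then have "(deriv ^^ i) h 0 = (\<Sum>k<n. of_nat (i choose k) * (- 1) ^ (i - k) * pcoeff h k)"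
        unfolding deriv_eq_sum_pcoeff[OF h] by (intro sum.mono_neutral_left) auto
      then show "of_nat (n choose (N + 1 + i)) * (deriv ^^ i) h 0 =
          (\<Sum>k<n. of_real (real (n choose (N + 1 + i)) * ((- 1) ^ (i - k) * real (i choose k))) * pcoeff h k)"
        by (simp add: sum_distrib_left mult_ac)
    qed
    also have "\<dots> = (\<Sum>k<n. of_real (\<Sum>i<n - N. real (n choose (N + 1 + i)) * ((- 1) ^ (i - k) * real (i choose k))) * pcoeff h k)"
      by (subst sum.swap) (simp only: of_real_sum sum_distrib_right)
    also have "\<dots> = (\<Sum>k<n. pcoeff h k * of_nat ((n - k - 1) choose N))"
      using n by (intro sum.cong refl, subst alternating_Vandermonde_shift) (auto simp: mult.commute)
    finally show ?thesis by simp
  qed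
  ultimately show ?thesis by (simp add: algebra_simps)
qed

section \<open>Bounding the remainder\<close>

lemma entire_exp_sums:
  assumes "h holomorphic_on UNIV"
  shows "(\<lambda>k. pcoeff h k / fact k * (exp (- x) * x ^ k)) sums h x"
proof -
  have "(\<lambda>k. exp (- x) * (pcoeff h k / fact k * x ^ k)) sums (exp (- x) * (exp x * h x))"
    by (intro sums_mult pcoeff_sums assms)
  moreover have "exp (- x) * (exp x * h x) = h x" by (simp add: exp_minus)
  ultimately show ?thesis by (simp only: mult.left_commute[of "exp (- x)"])
qed

lemma E_nonneg:
  assumes "h holomorphic_on UNIV" "r \<ge> 0"
  shows "E h r \<ge> 0"
  unfolding E_def using assms E_summable[OF assms(1)]
  by (intro mult_nonneg_nonneg suminf_nonneg) auto

lemma exp_mult_E: "exp r * E h r = (\<Sum>m. cmod (pcoeff h m) / fact m * r ^ m)"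
  by (simp add: E_def mult.assoc[symmetric] flip: exp_add)

text \<open>For k >= n and t <= x, t^k <= x^k * (t / x)^n, so the tail is at most (t / x)^n times
  the full series of absolute values at x.\<close>

lemma exp_tail_bound:
  assumes h: "h holomorphic_on UNIV" and t: "0 \<le> t" "t \<le> x" and x: "x > 0"
  shows "cmod (h (of_real t) - (\<Sum>k<n. pcoeff h k / fact k * of_real (exp (- t) * t ^ k)))
     \<le> exp x * E h x / x ^ n * (exp (- t) * t ^ n)"
proof -
  define a where "a k = cmod (pcoeff h k) / fact k * x ^ k" for k
  have a: "summable a" unfolding a_def by (rule E_summable[OF h])
  have nn: "a k \<ge> 0" for k using x by (simp add: a_def)
  have S: "exp x * E h x = suminf a"
    by (simp only: exp_mult_E a_def[abs_def])
  define b where "b k = pcoeff h k / fact k * of_real (exp (- t) * t ^ k)" for k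
  have b: "b sums h (of_real t)"
    using entire_exp_sums[OF h, of "of_real t"] by (simp add: b_def[abs_def] exp_of_real flip: of_real_minus)
  have le: "norm (b (k + n)) \<le> a (k + n) * (exp (- t) * (t / x) ^ n)" for k
  proof -
    have "norm (b (k + n)) = cmod (pcoeff h (k + n)) / fact (k + n) * (exp (- t) * (x ^ (k + n) * (t / x) ^ (k + n)))"
      using t x by (simp add: b_def norm_mult norm_divide norm_power power_divide)
    also have "\<dots> \<le> cmod (pcoeff h (k + n)) / fact (k + n) * (exp (- t) * (x ^ (k + n) * (t / x) ^ n))"
      using t x by (intro mult_left_mono power_decreasing) auto
    finally show ?thesis by (simp add: a_def mult_ac)
  qed
  have sm: "summable (\<lambda>k. a (k + n) * (exp (- t) * (t / x) ^ n))"
    using a by (intro summable_mult2) (simp add: summable_iff_shift)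
  have "h (of_real t) - (\<Sum>k<n. b k) = (\<Sum>k. b (k + n))"
    using b by (simp add: sums_iff suminf_minus_initial_segment)
  then have "cmod (h (of_real t) - (\<Sum>k<n. b k)) \<le> (\<Sum>k. a (k + n) * (exp (- t) * (t / x) ^ n))"
    using norm_suminf_le[OF le sm] by simp
  also have "\<dots> = (\<Sum>k. a (k + n)) * (exp (- t) * (t / x) ^ n)"
    using a by (intro suminf_mult2[symmetric]) (simp add: summable_iff_shift)
  also have "\<dots> \<le> suminf a * (exp (- t) * (t / x) ^ n)"
    using a nn t x suminf_minus_initial_segment[OF a, of n] by (intro mult_right_mono) (auto intro!: sum_nonneg)
  also have "\<dots> = exp x * E h x / x ^ n * (exp (- t) * t ^ n)"
    using x by (simp add: S power_divide)
  finally show ?thesis by (simp add: b_def)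
qed

text \<open>Now t / x >= 1 and k < n, so t^k <= x^k * (t / x)^n again: the majorant is the same on
  both sides of x.\<close>

lemma exp_partial_sum_bound:
  assumes h: "h holomorphic_on UNIV" and t: "x \<le> t" and x: "x > 0"
  shows "cmod (\<Sum>k<n. pcoeff h k / fact k * of_real (exp (- t) * t ^ k))
     \<le> exp x * E h x / x ^ n * (exp (- t) * t ^ n)"
proof -
  define a where "a k = cmod (pcoeff h k) / fact k * x ^ k" for k
  have a: "summable a" unfolding a_def by (rule E_summable[OF h])
  have nn: "a k \<ge> 0" for k using x by (simp add: a_def)
  have S: "exp x * E h x = suminf a"
    by (simp only: exp_mult_E a_def[abs_def])
  have "cmod (\<Sum>k<n. pcoeff h k / fact k * of_real (exp (- t) * t ^ k)) \<le>
      (\<Sum>k<n. a k * (exp (- t) * (t / x) ^ n))"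
  proof (rule sum_norm_le)
    fix k assume k: "k \<in> {..<n}"
    have "norm (pcoeff h k / fact k * of_real (exp (- t) * t ^ k)) =
        cmod (pcoeff h k) / fact k * (exp (- t) * (x ^ k * (t / x) ^ k))"
      using t x by (simp add: norm_mult norm_divide norm_power power_divide)
    also have "\<dots> \<le> cmod (pcoeff h k) / fact k * (exp (- t) * (x ^ k * (t / x) ^ n))"
      using t x k by (intro mult_left_mono power_increasing) auto
    finally show "norm (pcoeff h k / fact k * of_real (exp (- t) * t ^ k)) \<le> a k * (exp (- t) * (t / x) ^ n)"
      by (simp add: a_def mult_ac)
  qed
  also have "\<dots> = (\<Sum>k<n. a k) * (exp (- t) * (t / x) ^ n)" by (simp add: sum_distrib_right)
  also have "\<dots> \<le> suminf a * (exp (- t) * (t / x) ^ n)"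
    using a nn t x by (intro mult_right_mono sum_le_suminf) auto
  also have "\<dots> = exp x * E h x / x ^ n * (exp (- t) * t ^ n)"
    using x by (simp add: S power_divide)
  finally show ?thesis .
qed

text \<open>The constant is uniform because \<open>f\<close> enters the bound only through the
  factor \<open>K\<close>; what remains is the weighted integral of the Laguerre polynomial.\<close>

lemma pcoeff_taylor_remainder_bound:
  "\<exists>C\<ge>0. \<forall>f n. f holomorphic_on UNIV \<longrightarrow> N < n \<longrightarrow>
     cmod (pcoeff f n - (\<Sum>m=0..N. (deriv ^^ m) f (of_nat n) / fact m * tau m n))
       \<le> C * sqrt (real n) ^ (N + 1) * E ((deriv ^^ (N + 1)) f) (real n)"
proof -
  obtain C where C: "C \<ge> 0" "\<And>n. n \<ge> 1 \<Longrightarrow> \<exists>G I. (G has_integral I) {0..} \<and> I \<le> C * sqrt (real n) ^ N * fact n \<and>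
     (\<forall>t\<ge>0. exp (- t) * t ^ n * \<bar>laguerre n N t\<bar> \<le> G t)"
    using laguerre_weighted_integral[of N] by blast
  have "cmod (pcoeff f n - (\<Sum>m=0..N. (deriv ^^ m) f (of_nat n) / fact m * tau m n))
       \<le> (C * exp 1) * sqrt (real n) ^ (N + 1) * E ((deriv ^^ (N + 1)) f) (real n)"
    if f: "f holomorphic_on UNIV" and n: "N < n" for f n
  proof -
    define h where "h = (deriv ^^ (N + 1)) f"
    define D where "D = pcoeff f n - (\<Sum>m=0..N. (deriv ^^ m) f (of_nat n) / fact m * tau m n)"
    define V where "V = (\<Sum>k<n. pcoeff h k * of_nat ((n - k - 1) choose N))"
    define h1 where "h1 t = (\<Sum>k<n. pcoeff h k / fact k * of_real (exp (- t) * t ^ k))" for t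
    define K where "K = exp (real n) * E h (real n) / real n ^ n"
    have h: "h holomorphic_on UNIV"
      unfolding h_def using f by (intro holomorphic_higher_deriv) auto
    have K: "K \<ge> 0" unfolding K_def using E_nonneg[OF h, of "real n"] by simp
    from C(2)[of n] n obtain G I where G: "(G has_integral I) {0..}" "I \<le> C * sqrt (real n) ^ N * fact n"
      "\<And>t. t \<ge> 0 \<Longrightarrow> exp (- t) * t ^ n * \<bar>laguerre n N t\<bar> \<le> G t" by auto
    have "((\<lambda>t. h (of_real t) * of_real (laguerre n N t)) has_integral V - D) {0..real n}"
      unfolding V_def D_def h_def using f n by (rule pcoeff_remainder)
    then have 1: "((\<lambda>t. if t \<in> {0..real n} then h (of_real t) * of_real (laguerre n N t) else 0) has_integral V - D) {0..}"
      by (subst has_integral_restrict) auto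
    have "((\<lambda>t. \<Sum>k<n. pcoeff h k / fact k * of_real (exp (- t) * t ^ k * laguerre n N t)) has_integral
        (\<Sum>k<n. pcoeff h k / fact k * of_real (fact k * real ((n - k - 1) choose N)))) {0..}"
      by (intro has_integral_sum has_integral_mult_right has_integral_of_real laguerre_moment) auto
    also have "(\<Sum>k<n. pcoeff h k / fact k * of_real (fact k * real ((n - k - 1) choose N))) = V"
      by (simp add: V_def)
    also have "(\<lambda>t. \<Sum>k<n. pcoeff h k / fact k * of_real (exp (- t) * t ^ k * laguerre n N t)) =
        (\<lambda>t. h1 t * of_real (laguerre n N t))"
      by (simp add: h1_def sum_distrib_right mult.assoc)
    finally have "((\<lambda>t. h1 t * of_real (laguerre n N t)) has_integral V) {0..}" .
    from has_integral_diff[OF this 1]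
    \<comment> \<open>The two copies of \<open>V\<close> cancel. The integrand carries minus the
      tail of the series of \<open>h\<close> on {0..n} and its partial sum beyond n.\<close>
    have D: "((\<lambda>t. h1 t * of_real (laguerre n N t) - (if t \<in> {0..real n} then h (of_real t) * of_real (laguerre n N t) else 0)) has_integral D) {0..}"
      (is "(?u has_integral D) _") by simp
    have u: "cmod (?u t) \<le> K * G t" if t: "t \<in> {0..}" for t
    proof -
      have "?u t = (h1 t - (if t \<le> real n then h (of_real t) else 0)) * of_real (laguerre n N t)"
        using t by (simp add: algebra_simps)
      moreover have "cmod (h1 t - (if t \<le> real n then h (of_real t) else 0)) \<le> K * (exp (- t) * t ^ n)"
        using exp_tail_bound[OF h, of t "real n" n] exp_partial_sum_bound[OF h, of "real n" t n] t n
        by (auto simp: h1_def K_def norm_minus_commute)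
      ultimately have "cmod (?u t) \<le> K * (exp (- t) * t ^ n) * \<bar>laguerre n N t\<bar>"
        by (simp only: norm_mult norm_of_real) (intro mult_right_mono, auto)
      also have "\<dots> \<le> K * G t"
        using mult_left_mono[OF G(3)[of t] K] t by (simp add: mult_ac)
      finally show ?thesis .
    qed
    have "cmod (integral {0..} ?u) \<le> integral {0..} (\<lambda>t. K * G t)"
      using D has_integral_mult_right[OF G(1), of K] u
      by (intro integral_norm_bound_integral) (auto simp: integrable_on_def)
    then have "cmod D \<le> K * I"
      by (simp only: integral_unique[OF D] integral_unique[OF has_integral_mult_right[OF G(1), of K]])
    also have "\<dots> \<le> K * (C * sqrt (real n) ^ N * fact n)"
      using G(2) K by (intro mult_left_mono)
    \<comment> \<open>Stirling bounds n! * exp n / n^n by e * sqrt n: the exponent of sqrt n rises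
      from N to N + 1.\<close>
    also have "\<dots> \<le> K * (C * sqrt (real n) ^ N * (exp 1 * sqrt (real n) * (real n / exp 1) ^ n))"
      using K C n by (intro mult_left_mono fact_le_Stirling) auto
    also have "\<dots> = (C * exp 1) * sqrt (real n) ^ (N + 1) * E h (real n)"
      using n by (simp add: K_def power_divide exp_of_nat_mult[of n 1, simplified] field_simps)
    finally show ?thesis by (simp add: D_def h_def)
  qed
  then show ?thesis using C(1) by (intro exI[of _ "C * exp 1"]) auto
qed

section \<open>Growth under the functional equation\<close>

lemma holomorphic_half:
  fixes h :: "complex \<Rightarrow> complex"
  assumes "h holomorphic_on UNIV"
  shows "(\<lambda>z. h (z / 2)) holomorphic_on UNIV"
proof -
  have "h \<circ> (\<lambda>z. z / 2) holomorphic_on UNIV"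
    using assms by (intro holomorphic_on_compose holomorphic_intros) (auto intro: holomorphic_on_subset)
  then show ?thesis by (simp add: o_def)
qed

lemma pcoeff_add_cmult:
  assumes "h1 holomorphic_on UNIV" "h2 holomorphic_on UNIV"
  shows "pcoeff (\<lambda>z. c * h1 z + h2 z) m = c * pcoeff h1 m + pcoeff h2 m"
proof -
  have c: "(\<lambda>z. c * h1 z) holomorphic_on UNIV" by (intro holomorphic_intros assms)
  then have "(\<lambda>z. c * h1 z + h2 z) holomorphic_on UNIV" by (intro holomorphic_intros assms)
  then show ?thesis
    using higher_deriv_add[OF c assms(2) open_UNIV, of 0] higher_deriv_cmult[OF assms(1) _ open_UNIV, of 0 _ c]
    by (simp add: pcoeff_eq_sum_deriv assms sum.distrib sum_distrib_left algebra_simps)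
qed

lemma E_add_cmult_le:
  assumes h: "h1 holomorphic_on UNIV" "h2 holomorphic_on UNIV" and r: "r \<ge> 0"
  shows "E (\<lambda>z. c * h1 z + h2 z) r \<le> cmod c * E h1 r + E h2 r"
proof -
  have H: "(\<lambda>z. c * h1 z + h2 z) holomorphic_on UNIV" by (intro holomorphic_intros h)
  have "(\<Sum>m. cmod (pcoeff (\<lambda>z. c * h1 z + h2 z) m) / fact m * r ^ m) \<le>
      (\<Sum>m. cmod c * (cmod (pcoeff h1 m) / fact m * r ^ m) + cmod (pcoeff h2 m) / fact m * r ^ m)"
  proof (rule suminf_le)
    fix m
    have "cmod (pcoeff (\<lambda>z. c * h1 z + h2 z) m) \<le> cmod c * cmod (pcoeff h1 m) + cmod (pcoeff h2 m)"
      unfolding pcoeff_add_cmult[OF h] by (metis norm_mult norm_triangle_ineq)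
    then have "cmod (pcoeff (\<lambda>z. c * h1 z + h2 z) m) * (r ^ m / fact m) \<le>
        (cmod c * cmod (pcoeff h1 m) + cmod (pcoeff h2 m)) * (r ^ m / fact m)"
      using r by (intro mult_right_mono) auto
    then show "cmod (pcoeff (\<lambda>z. c * h1 z + h2 z) m) / fact m * r ^ m \<le>
        cmod c * (cmod (pcoeff h1 m) / fact m * r ^ m) + cmod (pcoeff h2 m) / fact m * r ^ m"
      by (simp add: algebra_simps)
  qed (intro E_summable H summable_add summable_mult h)+
  also have "\<dots> = cmod c * (\<Sum>m. cmod (pcoeff h1 m) / fact m * r ^ m) + (\<Sum>m. cmod (pcoeff h2 m) / fact m * r ^ m)"
    using suminf_add[OF summable_mult[OF E_summable[OF h(1)]] E_summable[OF h(2)], of "cmod c" r r]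
      suminf_mult[OF E_summable[OF h(1)], of "cmod c" r] by simp
  finally have "exp (- r) * (\<Sum>m. cmod (pcoeff (\<lambda>z. c * h1 z + h2 z) m) / fact m * r ^ m) \<le>
      exp (- r) * (cmod c * (\<Sum>m. cmod (pcoeff h1 m) / fact m * r ^ m) + (\<Sum>m. cmod (pcoeff h2 m) / fact m * r ^ m))"
    by (intro mult_left_mono) auto
  then show ?thesis unfolding E_def by (simp add: algebra_simps)
qed

text \<open>Splits exp x * h(x/2) into exp(x/2) and exp(x/2) * h(x/2); the second factor is the
  series of exp x * h(x) taken at x/2.\<close>

lemma pcoeff_half:
  assumes h: "h holomorphic_on UNIV"
  shows "pcoeff (\<lambda>z. h (z / 2)) m / fact m =
    (\<Sum>i\<le>m. ((1/2) ^ i / fact i) * (pcoeff h (m - i) / fact (m - i) * (1/2) ^ (m - i)))"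
proof -
  define F where "F = fps_expansion h 0"
  define G where "G = fps_expansion (\<lambda>z. h (z / 2)) 0"
  have h2: "(\<lambda>z. h (z / 2)) holomorphic_on UNIV"
    using h by (rule holomorphic_half)
  have G: "fps_nth G k = (1/2) ^ k * fps_nth F k" for k
    using higher_deriv_compose_linear[OF h open_UNIV open_UNIV, of 0 "1/2" k]
    by (simp add: G_def F_def fps_expansion_def)
  have half: "fps_nth (fps_exp (1/2) * G) k = (1/2) ^ k * fps_nth (fps_exp 1 * F) k" for k
    unfolding fps_mult_nth sum_distrib_left
    by (intro sum.cong refl) (simp add: G power_add[symmetric] power_divide field_simps)
  have "pcoeff (\<lambda>z. h (z / 2)) m / fact m = fps_nth (fps_exp 1 * G) m"
    by (simp add: pcoeff_def fps_expansion_exp_mult[OF h2] G_def)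
  also have "fps_exp 1 * G = fps_exp (1/2) * (fps_exp (1/2) * G)"
    by (simp add: mult.assoc[symmetric] flip: fps_exp_add_mult)
  also have "fps_nth (fps_exp (1/2) * (fps_exp (1/2) * G)) m =
      (\<Sum>i\<le>m. ((1/2) ^ i / fact i) * ((1/2) ^ (m - i) * fps_nth (fps_exp 1 * F) (m - i)))"
    by (simp only: fps_mult_nth[of _ _ m] half fps_exp_nth of_nat_fact atMost_atLeast0)
  also have "\<dots> = (\<Sum>i\<le>m. ((1/2) ^ i / fact i) * (pcoeff h (m - i) / fact (m - i) * (1/2) ^ (m - i)))"
    by (intro sum.cong refl) (simp add: pcoeff_def fps_expansion_exp_mult[OF h] F_def)
  finally show ?thesis .
qed

text \<open>Absolute values in the Cauchy product of \<open>pcoeff_half\<close> give at most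
  exp(r/2) times the series of \<open>E h (r / 2)\<close>, as exp(x/2) has positive coefficients;
  exp(-r) * exp(r/2) leaves the right normalization.\<close>

lemma E_half_le:
  assumes h: "h holomorphic_on UNIV" and r: "r \<ge> 0"
  shows "E (\<lambda>z. h (z / 2)) r \<le> E h (r / 2)"
proof -
  define a where "a i = (r / 2) ^ i / fact i" for i
  define b where "b i = cmod (pcoeff h i) / fact i * (r / 2) ^ i" for i
  have a: "a sums exp (r / 2)" "a i \<ge> 0" for i
    using exp_converges[of "r / 2"] r by (simp_all add: a_def[abs_def] field_simps)
  have b: "summable b" "b i \<ge> 0" for i
    using E_summable[OF h, of "r / 2"] r by (simp_all add: b_def[abs_def])
  have h2: "(\<lambda>z. h (z / 2)) holomorphic_on UNIV"
    using h by (rule holomorphic_half)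
  have ab: "(\<lambda>k. \<Sum>i\<le>k. a i * b (k - i)) sums ((\<Sum>k. a k) * (\<Sum>k. b k))"
    using a b by (intro Cauchy_product_sums) (simp_all add: sums_iff)
  have "(\<Sum>m. cmod (pcoeff (\<lambda>z. h (z / 2)) m) / fact m * r ^ m) \<le> (\<Sum>m. \<Sum>i\<le>m. a i * b (m - i))"
  proof (rule suminf_le)
    fix m
    have "cmod (pcoeff (\<lambda>z. h (z / 2)) m) / fact m = cmod (pcoeff (\<lambda>z. h (z / 2)) m / fact m)"
      by (simp add: norm_divide)
    also have "\<dots> \<le> (\<Sum>i\<le>m. cmod (((1/2) ^ i / fact i) * (pcoeff h (m - i) / fact (m - i) * (1/2) ^ (m - i))))"
      unfolding pcoeff_half[OF h] by (rule norm_sum)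
    finally have "cmod (pcoeff (\<lambda>z. h (z / 2)) m) / fact m * r ^ m \<le>
        (\<Sum>i\<le>m. cmod (((1/2) ^ i / fact i) * (pcoeff h (m - i) / fact (m - i) * (1/2) ^ (m - i)))) * r ^ m"
      using r by (intro mult_right_mono) auto
    also have "\<dots> = (\<Sum>i\<le>m. a i * b (m - i))"
      unfolding sum_distrib_right
    proof (intro sum.cong refl)
      fix i assume "i \<in> {..m}"
      then have "r ^ m = r ^ i * r ^ (m - i)" by (simp flip: power_add)
      then show "cmod (((1/2) ^ i / fact i) * (pcoeff h (m - i) / fact (m - i) * (1/2) ^ (m - i))) * r ^ m = a i * b (m - i)"
        by (simp add: a_def b_def norm_mult norm_divide norm_power power_divide)
    qed
    finally show "cmod (pcoeff (\<lambda>z. h (z / 2)) m) / fact m * r ^ m \<le> (\<Sum>i\<le>m. a i * b (m - i))" .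
  next
    show "summable (\<lambda>m. cmod (pcoeff (\<lambda>z. h (z / 2)) m) / fact m * r ^ m)" by (rule E_summable[OF h2])
    show "summable (\<lambda>m. \<Sum>i\<le>m. a i * b (m - i))" using ab by (simp add: sums_iff)
  qed
  also have "\<dots> = exp (r / 2) * (\<Sum>m. b m)" using ab a(1) by (simp add: sums_iff)
  finally have "exp (- r) * (\<Sum>m. cmod (pcoeff (\<lambda>z. h (z / 2)) m) / fact m * r ^ m) \<le> exp (- r) * (exp (r / 2) * (\<Sum>m. b m))"
    by (intro mult_left_mono) auto
  also have "\<dots> = exp (- (r / 2)) * (\<Sum>m. b m)"
  proof -
    have "exp (- r) * exp (r / 2) = exp (- (r / 2))" by (simp flip: exp_add)
    then show ?thesis by (simp only: mult.assoc[symmetric])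
  qed
  finally show ?thesis unfolding E_def b_def .
qed

text \<open>The weight in H r = r^N * E h r absorbs the factor (1/2)^N, so each halving of r costs
  only an additive constant. About log r halvings reach a bounded interval, whence the
  logarithm.\<close>

lemma E_functional_equation_growth:
  assumes h: "h holomorphic_on UNIV" and g: "g holomorphic_on UNIV"
    and eq: "\<And>z. h z = (1/2) ^ N * h (z / 2) + g z"
    and O: "(\<lambda>r. E g r) \<in> O[at_top](\<lambda>r. 1 / r ^ N)"
  shows "(\<lambda>n. E h (real n)) \<in> O[at_top](\<lambda>n. ln (real n) / real n ^ N)"
proof -
  obtain c where c: "c > 0" "eventually (\<lambda>r. norm (E g r) \<le> c * norm (1 / r ^ N)) at_top"
    using O by (elim landau_o.bigE)
  then obtain R0 where R0: "\<And>r. r \<ge> R0 \<Longrightarrow> norm (E g r) \<le> c * norm (1 / r ^ N)"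
    by (auto simp: eventually_at_top_linorder)
  define R where "R = max R0 1"
  define H where "H r = r ^ N * E h r" for r
  have R: "R \<ge> 1" by (simp add: R_def)
  have h2: "(\<lambda>z. h (z / 2)) holomorphic_on UNIV"
    using h by (rule holomorphic_half)
  have step: "H r \<le> H (r / 2) + c" if r: "r \<ge> R" for r
  proof -
    have r0: "r > 0" using r R by simp
    have "E h r = E (\<lambda>z. (1/2) ^ N * h (z / 2) + g z) r"
      by (intro arg_cong2[where f = E] ext eq refl)
    also have "\<dots> \<le> cmod ((1/2) ^ N) * E (\<lambda>z. h (z / 2)) r + E g r"
      using r0 by (intro E_add_cmult_le h2 g) auto
    also have "\<dots> \<le> (1/2) ^ N * E h (r / 2) + c / r ^ N"
    proof (intro add_mono)
      show "cmod ((1/2) ^ N) * E (\<lambda>z. h (z / 2)) r \<le> (1/2) ^ N * E h (r / 2)"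
        using r0 E_half_le[OF h, of r] by (simp add: norm_power norm_divide)
      show "E g r \<le> c / r ^ N"
        using R0[of r] r r0 by (simp add: R_def)
    qed
    finally have "H r \<le> r ^ N * ((1/2) ^ N * E h (r / 2) + c / r ^ N)"
      unfolding H_def using r0 by (intro mult_left_mono) auto
    also have "\<dots> = H (r / 2) + c"
      using r0 by (simp add: H_def power_divide field_simps)
    finally show ?thesis .
  qed
  \<comment> \<open>Bounds \<open>H\<close> on the base interval from R to 2 * R: the power series
    increases with r, and exp(-r) is at most 1.\<close>
  define M where "M = (2 * R) ^ N * (\<Sum>m. cmod (pcoeff h m) / fact m * (2 * R) ^ m)"
  have base: "H r \<le> M" if r: "R \<le> r" "r \<le> 2 * R" for r
  proof -
    have "(\<Sum>m. cmod (pcoeff h m) / fact m * r ^ m) \<le> (\<Sum>m. cmod (pcoeff h m) / fact m * (2 * R) ^ m)"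
      using r R by (intro suminf_le E_summable h mult_left_mono power_mono) auto
    moreover have "0 \<le> (\<Sum>m. cmod (pcoeff h m) / fact m * r ^ m)"
      using r R by (intro suminf_nonneg E_summable h) auto
    moreover have "exp (- r) \<le> 1" using r R by simp
    ultimately have "E h r \<le> 1 * (\<Sum>m. cmod (pcoeff h m) / fact m * (2 * R) ^ m)"
      unfolding E_def by (intro mult_mono) auto
    then show ?thesis
      unfolding H_def M_def using r R E_nonneg[OF h, of r] by (intro mult_mono power_mono) auto
  qed
  have M0: "M \<ge> 0"
    unfolding M_def using R by (intro mult_nonneg_nonneg suminf_nonneg E_summable h) auto
  have growth: "H r \<le> M + real j * c" if "R \<le> r" "r \<le> 2 ^ Suc j * R" for r j
    using that
  proof (induction j arbitrary: r)
    case 0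
    then show ?case using base by simp
  next
    case (Suc j)
    show ?case
    proof (cases "r \<le> 2 * R")
      case True
      have "0 \<le> real (Suc j) * c" using c by simp
      with base[OF Suc.prems(1) True] show ?thesis by linarith
    next
      case False
      then have "H (r / 2) \<le> M + real j * c" using Suc.prems by (intro Suc.IH) auto
      with step[OF Suc.prems(1)] show ?thesis by (simp add: algebra_simps)
    qed
  qed
  have bound: "norm (E h (real n)) \<le> ((M + 2 * c) / ln 2) * norm (ln (real n) / real n ^ N)" if n: "n \<ge> 2" "real n \<ge> R" for n
  proof -
    \<comment> \<open>For n >= 2, log 2 n >= 1, so j <= 2 * log 2 n and M + j * c <= (M + 2 * c) *
      log 2 n.\<close>
    define j where "j = nat \<lceil>log 2 (real n)\<rceil>"
    have l1: "log 2 (real n) \<ge> 1" using n by (simp add: le_log_iff)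
    have "real n \<le> 2 powr real j"
      using n unfolding j_def by (subst log_le_iff[symmetric]) (auto simp: real_nat_ceiling_ge)
    also have "\<dots> \<le> 2 ^ Suc j * 1" by (simp add: powr_realpow)
    also have "\<dots> \<le> 2 ^ Suc j * R" using R by (intro mult_left_mono) auto
    finally have "H (real n) \<le> M + real j * c" using n by (intro growth) auto
    also have "\<dots> \<le> M * log 2 (real n) + (2 * log 2 (real n)) * c"
    proof (intro add_mono mult_right_mono)
      show "M \<le> M * log 2 (real n)" using M0 l1 by (simp add: mult_le_cancel_left1)
      show "real j \<le> 2 * log 2 (real n)" unfolding j_def using l1 by linarith
    qed (use c in auto)
    also have "\<dots> = ((M + 2 * c) / ln 2) * ln (real n)" by (simp add: log_def algebra_simps add_divide_distrib)
    finally have "real n ^ N * E h (real n) \<le> ((M + 2 * c) / ln 2) * ln (real n)" by (simp add: H_def)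
    then have "E h (real n) \<le> ((M + 2 * c) / ln 2) * (ln (real n) / real n ^ N)"
      using n by (simp add: field_simps)
    then show ?thesis using E_nonneg[OF h, of "real n"] n by simp
  qed
  have "eventually (\<lambda>n. n \<ge> 2 \<and> real n \<ge> R) at_top"
  proof (rule eventually_conj)
    show "eventually (\<lambda>n. n \<ge> 2) (at_top :: nat filter)" by (rule eventually_ge_at_top)
    show "eventually (\<lambda>n. real n \<ge> R) at_top"
      using filterlim_real_sequentially by (simp add: filterlim_at_top)
  qed
  then have "eventually (\<lambda>n. norm (E h (real n)) \<le> ((M + 2 * c) / ln 2) * norm (ln (real n) / real n ^ N)) at_top"
    by (rule eventually_mono) (use bound in blast)
  then show ?thesis by (rule bigoI)
qed

section \<open>Combining the remainder bound with the growth estimate\<close>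

theorem theorem12:
  fixes f g :: "complex \<Rightarrow> complex" and N :: nat
  assumes "f holomorphic_on UNIV" and "g holomorphic_on UNIV"
    and "\<And>x::real. f (of_real x) \<in> \<real>" and "\<And>x::real. g (of_real x) \<in> \<real>"
    and "\<And>z. f z = 2 * f (z / 2) + g z"
    and "(\<lambda>r. E ((deriv ^^ (N + 1)) g) r) \<in> O[at_top](\<lambda>r. 1 / r ^ N)"
  shows "(\<lambda>n::nat. cmod (pcoeff f n -
             (\<Sum>m=0..N. (deriv ^^ m) f (of_nat n) / fact m * tau m n)))
           \<in> O[at_top](\<lambda>n. ln (real n) / real n powr ((real N - 1) / 2))"
proof -
  define h where "h = (deriv ^^ (N + 1)) f"
  have h: "h holomorphic_on UNIV"
    unfolding h_def using assms(1) by (intro holomorphic_higher_deriv) auto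
  have g: "(deriv ^^ (N + 1)) g holomorphic_on UNIV"
    using assms(2) by (intro holomorphic_higher_deriv) auto
  have half: "(\<lambda>z. f (z / 2)) holomorphic_on UNIV"
    using assms(1) by (rule holomorphic_half)
  \<comment> \<open>Differentiating f(z/2) N + 1 times yields (1/2)^(N+1), and the factor 2 of the
    functional equation leaves (1/2)^N.\<close>
  have eq: "h z = (1/2) ^ N * h (z / 2) + (deriv ^^ (N + 1)) g z" for z
  proof -
    have "h z = (deriv ^^ (N + 1)) (\<lambda>z. 2 * f (z / 2) + g z) z"
      unfolding h_def using assms(5) by (metis (no_types, lifting) ext)
    also have "\<dots> = 2 * (deriv ^^ (N + 1)) (\<lambda>z. f (z / 2)) z + (deriv ^^ (N + 1)) g z"
      using higher_deriv_add[OF holomorphic_on_mult[OF holomorphic_on_const half] assms(2) open_UNIV, of z "N + 1" 2]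
        higher_deriv_cmult[OF half _ open_UNIV, of z "N + 1" 2] by simp
    also have "(deriv ^^ (N + 1)) (\<lambda>z. f (z / 2)) z = (1/2) ^ (N + 1) * h (z / 2)"
      using higher_deriv_compose_linear[OF assms(1) open_UNIV open_UNIV, of z "1/2" "N + 1"]
      by (simp add: h_def)
    finally show ?thesis by simp
  qed
  have growth: "(\<lambda>n. E h (real n)) \<in> O[at_top](\<lambda>n. ln (real n) / real n ^ N)"
    using h g eq assms(6) by (rule E_functional_equation_growth)
  obtain C where C: "C \<ge> 0" "\<And>n. N < n \<Longrightarrow> cmod (pcoeff f n - (\<Sum>m=0..N. (deriv ^^ m) f (of_nat n) / fact m * tau m n))
       \<le> C * sqrt (real n) ^ (N + 1) * E h (real n)"
    using pcoeff_taylor_remainder_bound[of N] assms(1) unfolding h_def by blast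
  have "(\<lambda>n. cmod (pcoeff f n - (\<Sum>m=0..N. (deriv ^^ m) f (of_nat n) / fact m * tau m n)))
      \<in> O[at_top](\<lambda>n. sqrt (real n) ^ (N + 1) * E h (real n))"
  proof (rule bigoI)
    show "\<forall>\<^sub>F n in at_top. norm (cmod (pcoeff f n - (\<Sum>m=0..N. (deriv ^^ m) f (of_nat n) / fact m * tau m n)))
        \<le> C * norm (sqrt (real n) ^ (N + 1) * E h (real n))"
      using eventually_gt_at_top[of N]
    proof eventually_elim
      case (elim n)
      then show ?case using C(2)[OF elim] E_nonneg[OF h, of "real n"] by (simp add: mult.assoc)
    qed
  qed
  also have "(\<lambda>n. sqrt (real n) ^ (N + 1) * E h (real n)) \<in>
      O[at_top](\<lambda>n. sqrt (real n) ^ (N + 1) * (ln (real n) / real n ^ N))"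
    by (intro landau_o.big.mult landau_o.big_refl growth)
  \<comment> \<open>The exponents combine to (N + 1)/2 - N = -(N - 1)/2; n > 0 is needed to pass
    from \<open>^\<close> to \<open>powr\<close>.\<close>
  also have "(\<lambda>n. sqrt (real n) ^ (N + 1) * (ln (real n) / real n ^ N)) \<in>
      \<Theta>[at_top](\<lambda>n. ln (real n) / real n powr ((real N - 1) / 2))"
  proof (rule bigthetaI_cong)
    show "\<forall>\<^sub>F n in at_top. sqrt (real n) ^ (N + 1) * (ln (real n) / real n ^ N) =
        ln (real n) / real n powr ((real N - 1) / 2)"
      using eventually_gt_at_top[of 0]
    proof eventually_elim
      case (elim n)
      have p1: "sqrt (real n) ^ (N + 1) = real n powr (real (N + 1) / 2)"
      proof -
        have "sqrt (real n) ^ (N + 1) = (real n powr (1/2)) powr real (N + 1)"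
          using elim by (subst powr_realpow) (simp_all add: powr_half_sqrt)
        then show ?thesis by (simp add: powr_powr)
      qed
      have p2: "real n ^ N = real n powr real N" using elim by (simp add: powr_realpow)
      have p3: "real n powr (real (N + 1) / 2) / real n powr real N = 1 / real n powr ((real N - 1) / 2)"
      proof -
        have "real (N + 1) / 2 - real N = - ((real N - 1) / 2)" by (simp add: field_simps)
        then show ?thesis by (simp only: powr_diff[symmetric] powr_minus_divide[symmetric])
      qed
      have "sqrt (real n) ^ (N + 1) * (ln (real n) / real n ^ N) =
          ln (real n) * (sqrt (real n) ^ (N + 1) / real n ^ N)" by simp
      also have "\<dots> = ln (real n) * (1 / real n powr ((real N - 1) / 2))"
        by (simp only: p1 p2 p3)
      finally show ?case by simp
    qed
  qed
  finally show ?thesis .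
qed

end
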